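(* Let $m\ge 1$ and $n\ge 2$ be integers. The number $B_{m,n}$ of bimonotone subdivisions of the point configuration $P_{m,n}$ satisfies $$B_{m,n}=\begin{cases}2B_{m,n-1}+2B_{m-1,n}-2B_{m-1,n-1} & \text{if } m>n,\\ 2B_{m,n-1} & \text{if } m=n,\\ 0 & \text{if } m<n.\end{cases}$$
   Context: For integers $m,n\ge 1$, the point configuration $P_{m,n}\subset\mathbb R^2$ is the two-row grid consisting of the $n$ bottom points $(0,0),(1,0),\dots,(n-1,0)$ and the $m$ top points $(0,1),(1,1),\dots,(m-1,1)$. A subdivision of a finite point configuration $\mathcal A\subset\mathbb R^2$ is a collection of convex polygons (two-dimensional, with nonempty interior, regarded as convex sets) whose vertices lie in $\mathcal A$, such that the union of the polygons is the convex hull of $\mathcal A$ and each pair of distinct polygons either does not intersect or intersects exactly in a common vertex or a common side. Not all points of $\mathcal A$ need to be vertices of polygons. A polygon is bimonotone if every one of its edges is vertical or has nonnegative slope. A subdivision is bimonotone if all of its polygons are bimonotone. $B_{m,n}$ denotes the number of bimonotone subdivisions of $P_{m,n}$. *)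

theory Defs
  imports "HOL-Analysis.Analysis"
begin

definition two_row_grid :: "nat \<Rightarrow> nat \<Rightarrow> (real \<times> real) set" where
  "two_row_grid m n = {(real i, 0) | i. i < n} \<union> {(real j, 1) | j. j < m}"

definition convex_polygon :: "(real \<times> real) set \<Rightarrow> bool" where
  "convex_polygon Q \<longleftrightarrow> polytope Q \<and> interior Q \<noteq> {}"

definition polygon_vertices :: "(real \<times> real) set \<Rightarrow> (real \<times> real) set" where
  "polygon_vertices Q = {v. v extreme_point_of Q}"

definition is_subdivision :: "(real \<times> real) set \<Rightarrow> (real \<times> real) set set \<Rightarrow> bool" where
  "is_subdivision A S \<longleftrightarrow>
     (\<forall>Q\<in>S. convex_polygon Q \<and> polygon_vertices Q \<subseteq> A) \<and>
     \<Union>S = convex hull A \<and>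
     (\<forall>Q\<in>S. \<forall>R\<in>S. Q \<noteq> R \<longrightarrow>
        Q \<inter> R = {} \<or>
        (\<exists>v \<in> polygon_vertices Q \<inter> polygon_vertices R. Q \<inter> R = {v}) \<or>
        (Q \<inter> R) edge_of Q \<and> (Q \<inter> R) edge_of R)"

definition bimonotone_segment :: "(real \<times> real) set \<Rightarrow> bool" where
  "bimonotone_segment e \<longleftrightarrow>
     (\<exists>a b. a \<noteq> b \<and> e = closed_segment a b \<and>
        (fst a = fst b \<or> (snd b - snd a) / (fst b - fst a) \<ge> 0))"

definition bimonotone_polygon :: "(real \<times> real) set \<Rightarrow> bool" where
  "bimonotone_polygon Q \<longleftrightarrow> (\<forall>e. e edge_of Q \<longrightarrow> bimonotone_segment e)"

definition bimonotone_subdivisions :: "(real \<times> real) set \<Rightarrow> (real \<times> real) set set set" where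
  "bimonotone_subdivisions A = {S. is_subdivision A S \<and> (\<forall>Q\<in>S. bimonotone_polygon Q)}"

text \<open>Polygons are plain convex sets, without marked points, so a finite configuration has
  only finitely many subdivisions and their cardinality is meaningful.\<close>

lemma finite_bimonotone_subdivisions:
  assumes "finite A"
  shows "finite (bimonotone_subdivisions A)"
proof (rule finite_subset)
  show "bimonotone_subdivisions A \<subseteq> Pow ((\<lambda>V. convex hull V) ` Pow A)"
  proof (intro subsetI PowI)
    fix S Q assume "S \<in> bimonotone_subdivisions A" "Q \<in> S"
    then have "polytope Q" and V: "polygon_vertices Q \<subseteq> A"
      by (auto simp: bimonotone_subdivisions_def is_subdivision_def convex_polygon_def)
    then have "Q = convex hull (polygon_vertices Q)"
      unfolding polygon_vertices_def
      by (intro Krein_Milman_Minkowski polytope_imp_compact polytope_imp_convex)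
    with V show "Q \<in> (\<lambda>V. convex hull V) ` Pow A" by blast
  qed
  show "finite (Pow ((\<lambda>V. convex hull V) ` Pow A))" using assms by simp
qed

definition B :: "nat \<Rightarrow> nat \<Rightarrow> nat" where
  "B m n = card (bimonotone_subdivisions (two_row_grid m n))"

end

theory Submission
  imports Defs
begin

text \<open>A polygon with vertices on two rows is a triangle or trapezoid bounded by two cross segments
  \<open>(a, 0) - (c, 1)\<close> and \<open>(b, 0) - (d, 1)\<close> with \<open>a \<le> b\<close> and \<open>c \<le> d\<close>; it is bimonotone iff \<open>a \<le> c\<close>
  and \<open>b \<le> d\<close>. Exactly one polygon of a subdivision contains the right side of the strip. Removing
  it leaves a subdivision of the grid to the left of its left side \<open>(a, 0) - (c, 1)\<close>, or nothing if
  that is the segment from \<open>(0, 0)\<close> to \<open>(0, 1)\<close>; conversely every smaller subdivision extends.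
  So, for \<open>b \<le> d\<close>, the number \<open>f b d\<close> of subdivisions of the strip ending in \<open>(b, 0) - (d, 1)\<close> is
  the sum of all \<open>f a c\<close> with \<open>(a, c) < (b, d)\<close> componentwise, where \<open>f 0 0 = 1\<close>. The sum of \<open>f\<close>
  over the whole rectangle below \<open>(b, d)\<close> is therefore \<open>2 f b d\<close>, and inclusion-exclusion for
  rectangles gives the recurrence.\<close>

section \<open>Trapezoids in the strip between the two rows\<close>

text \<open>The arguments are the bottom and top ends of the left side, then those of the right side.\<close>

definition trap :: "real \<Rightarrow> real \<Rightarrow> real \<Rightarrow> real \<Rightarrow> (real \<times> real) set" where
  "trap a c b d = {(x, y). 0 \<le> y \<and> y \<le> 1 \<and> (1 - y) * a + y * c \<le> x \<and> x \<le> (1 - y) * b + y * d}"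

lemma mem_trap:
  "(x, y) \<in> trap a c b d \<longleftrightarrow> 0 \<le> y \<and> y \<le> 1 \<and> (1 - y) * a + y * c \<le> x \<and> x \<le> (1 - y) * b + y * d"
  by (simp add: trap_def)

text \<open>Expanding the products makes all four conditions linear, so convexity and closedness
  follow from half-spaces.\<close>

lemma trap_eq_halfspaces:
  "trap a c b d = {z. (0, 1) \<bullet> z \<ge> 0} \<inter> {z. (0, 1) \<bullet> z \<le> 1} \<inter>
     {z. (1, a - c) \<bullet> z \<ge> a} \<inter> {z. (1, b - d) \<bullet> z \<le> b}"
  by (auto simp: trap_def algebra_simps)

lemma convex_trap: "convex (trap a c b d)"
  unfolding trap_eq_halfspaces
  by (intro convex_Int convex_halfspace_le convex_halfspace_ge)

lemma closed_trap: "closed (trap a c b d)"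
  unfolding trap_eq_halfspaces
  by (intro closed_Int closed_halfspace_le closed_halfspace_ge)

lemma mem_side_segment:
  "(x, y) \<in> closed_segment (a, 0) (c, 1) \<longleftrightarrow> 0 \<le> y \<and> y \<le> 1 \<and> x = (1 - y) * a + y * (c :: real)"
  for y :: real
  by (auto simp: closed_segment_def)

text \<open>Each point lies on a horizontal chord whose two ends lie on the cross segments, hence in
  the hull.\<close>

lemma trap_eq_hull:
  assumes "a \<le> b" "c \<le> d"
  shows "trap a c b d = convex hull {(a, 0), (c, 1), (b, 0), (d, 1)}" (is "_ = ?H")
proof
  show "?H \<subseteq> trap a c b d"
    using assms by (intro hull_minimal convex_trap) (auto simp: mem_trap)
  show "trap a c b d \<subseteq> ?H"
  proof clarify
    fix x y assume *: "(x, y) \<in> trap a c b d"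
    let ?l = "(1 - y) * a + y * c" and ?r = "(1 - y) * b + y * d"
    have "(?l, y) \<in> closed_segment (a, 0) (c, 1)" "(?r, y) \<in> closed_segment (b, 0) (d, 1)"
      using * by (auto simp: mem_side_segment mem_trap)
    moreover have "closed_segment (a, 0) (c, 1) \<subseteq> ?H" "closed_segment (b, 0) (d, 1) \<subseteq> ?H"
      unfolding segment_convex_hull by (auto intro!: hull_mono)
    ultimately have "closed_segment (?l, y) (?r, y) \<subseteq> ?H"
      by (intro closed_segment_subset convex_convex_hull) auto
    moreover have "(x, y) \<in> closed_segment (?l, y) (?r, y)"
      using * by (auto simp: mem_trap closed_segment_PairD closed_segment_same_snd closed_segment_eq_real_ivl)
    ultimately show "(x, y) \<in> ?H" by blast
  qed
qed

text \<open>The strict inequalities cut out an open set. Conversely, a small step in each of the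
  four axis directions must stay inside, so no inequality can be tight.\<close>

lemma interior_trap:
  "interior (trap a c b d) =
    {(x, y). 0 < y \<and> y < 1 \<and> (1 - y) * a + y * c < x \<and> x < (1 - y) * b + y * d}" (is "_ = ?I")
proof
  have "?I = {z. (0, 1) \<bullet> z > 0} \<inter> {z. (0, 1) \<bullet> z < 1} \<inter>
     {z. (1, a - c) \<bullet> z > a} \<inter> {z. (1, b - d) \<bullet> z < b}"
    by (auto simp: algebra_simps)
  then have "open ?I"
    by (simp add: open_Int open_halfspace_lt open_halfspace_gt)
  then show "?I \<subseteq> interior (trap a c b d)"
    by (intro interior_maximal) (auto simp: mem_trap)
  show "interior (trap a c b d) \<subseteq> ?I"
  proof clarify
    fix x y assume "(x, y) \<in> interior (trap a c b d)"
    then obtain e where e: "e > 0" "cball (x, y) e \<subseteq> trap a c b d"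
      by (auto simp: mem_interior_cball)
    have "(x + e, y) \<in> cball (x, y) e" "(x - e, y) \<in> cball (x, y) e"
      "(x, y + e) \<in> cball (x, y) e" "(x, y - e) \<in> cball (x, y) e"
      using e(1) by (auto simp: dist_Pair_Pair dist_real_def)
    then have "(x + e, y) \<in> trap a c b d" "(x - e, y) \<in> trap a c b d"
      "(x, y + e) \<in> trap a c b d" "(x, y - e) \<in> trap a c b d"
      using e(2) by blast+
    then show "0 < y \<and> y < 1 \<and> (1 - y) * a + y * c < x \<and> x < (1 - y) * b + y * d"
      using e(1) by (auto simp: mem_trap)
  qed
qed

lemma interpolate_mono:
  assumes "a \<le> b" "c \<le> d" "0 \<le> y" "y \<le> 1"
  shows "(1 - y) * a + y * c \<le> (1 - y) * b + y * (d :: real)"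
  using assms by (intro add_mono mult_left_mono) auto

lemma interpolate_strict_mono:
  assumes "a \<le> b" "c \<le> d" "a < b \<or> c < d" "0 < y" "y < 1"
  shows "(1 - y) * a + y * c < (1 - y) * b + y * (d :: real)"
  using assms(3)
proof
  assume "a < b"
  with assms show ?thesis
    by (intro add_less_le_mono mult_strict_left_mono mult_left_mono) auto
next
  assume "c < d"
  with assms show ?thesis
    by (intro add_le_less_mono mult_strict_left_mono mult_left_mono) auto
qed

lemma interior_trap_nonempty_iff:
  assumes "a \<le> b" "c \<le> d"
  shows "interior (trap a c b d) \<noteq> {} \<longleftrightarrow> a < b \<or> c < d"
proof
  assume "interior (trap a c b d) \<noteq> {}"
  then obtain x y where "(x, y) \<in> interior (trap a c b d)" by fast
  then have "\<not> (a = b \<and> c = d)" by (auto simp: interior_trap)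
  with assms show "a < b \<or> c < d" by auto
next
  assume "a < b \<or> c < d"
  then have "(a + b + c + d) / 4 > (a + c) / 2" "(a + b + c + d) / 4 < (b + d) / 2"
    using assms by auto
  \<comment> \<open>The midpoint of the chord at height 1/2.\<close>
  then have "((a + b + c + d) / 4, 1 / 2) \<in> interior (trap a c b d)"
    by (simp add: interior_trap field_simps)
  then show "interior (trap a c b d) \<noteq> {}" by blast
qed

lemma polytope_trap: "a \<le> b \<Longrightarrow> c \<le> d \<Longrightarrow> polytope (trap a c b d)"
  by (simp add: trap_eq_hull polytope_convex_hull)

lemma convex_polygon_trap:
  assumes "a \<le> b" "c \<le> d" "a < b \<or> c < d"
  shows "convex_polygon (trap a c b d)"
  using assms by (simp add: convex_polygon_def polytope_trap interior_trap_nonempty_iff)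

section \<open>Faces and vertices of trapezoids\<close>

lemma polygon_vertices_trap_subset:
  assumes "a \<le> b" "c \<le> d"
  shows "polygon_vertices (trap a c b d) \<subseteq> {(a, 0), (c, 1), (b, 0), (d, 1)}"
  using extreme_points_of_convex_hull[of "{(a, 0), (c, 1), (b, 0), (d, 1)}"] assms
  by (simp add: polygon_vertices_def trap_eq_hull)

text \<open>Each side is cut out by a supporting line. Since \<open>a = b\<close> and
  \<open>c = d\<close> are allowed, the bottom or top may shrink to a point, hence faces rather than
  edges.\<close>

lemma trap_faces:
  assumes "a \<le> b" "c \<le> d"
  shows trap_left_face: "closed_segment (a, 0) (c, 1) face_of trap a c b d"
    and trap_right_face: "closed_segment (b, 0) (d, 1) face_of trap a c b d"
    and trap_bottom_face: "closed_segment (a, 0) (b, 0) face_of trap a c b d"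
    and trap_top_face: "closed_segment (c, 1) (d, 1) face_of trap a c b d"
proof -
  have "trap a c b d \<inter> {z. (1, a - c) \<bullet> z = a} face_of trap a c b d"
    by (intro face_of_Int_supporting_hyperplane_ge convex_trap) (auto simp: mem_trap algebra_simps)
  moreover have "(x, y) \<in> trap a c b d \<inter> {z. (1, a - c) \<bullet> z = a} \<longleftrightarrow>
      (x, y) \<in> closed_segment (a, 0) (c, 1)" for x y
    using interpolate_mono[OF assms, of y]
    by (auto simp: mem_side_segment mem_trap algebra_simps)
  then have "trap a c b d \<inter> {z. (1, a - c) \<bullet> z = a} = closed_segment (a, 0) (c, 1)"
    unfolding set_eq_iff split_paired_All by blast
  ultimately show "closed_segment (a, 0) (c, 1) face_of trap a c b d" by simp
  have "trap a c b d \<inter> {z. (1, b - d) \<bullet> z = b} face_of trap a c b d"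
    by (intro face_of_Int_supporting_hyperplane_le convex_trap) (auto simp: mem_trap algebra_simps)
  moreover have "(x, y) \<in> trap a c b d \<inter> {z. (1, b - d) \<bullet> z = b} \<longleftrightarrow>
      (x, y) \<in> closed_segment (b, 0) (d, 1)" for x y
    using interpolate_mono[OF assms, of y]
    by (auto simp: mem_side_segment mem_trap algebra_simps)
  then have "trap a c b d \<inter> {z. (1, b - d) \<bullet> z = b} = closed_segment (b, 0) (d, 1)"
    unfolding set_eq_iff split_paired_All by blast
  ultimately show "closed_segment (b, 0) (d, 1) face_of trap a c b d" by simp
  have "trap a c b d \<inter> {z. (0, 1) \<bullet> z = 0} face_of trap a c b d"
    by (intro face_of_Int_supporting_hyperplane_ge convex_trap) (auto simp: mem_trap)
  also have "trap a c b d \<inter> {z. (0, 1) \<bullet> z = 0} = closed_segment (a, 0) (b, 0)"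
    using assms
    by (auto simp: mem_trap closed_segment_same_snd closed_segment_eq_real_ivl)
  finally show "closed_segment (a, 0) (b, 0) face_of trap a c b d" .
  have "trap a c b d \<inter> {z. (0, 1) \<bullet> z = 1} face_of trap a c b d"
    by (intro face_of_Int_supporting_hyperplane_le convex_trap) (auto simp: mem_trap)
  also have "trap a c b d \<inter> {z. (0, 1) \<bullet> z = 1} = closed_segment (c, 1) (d, 1)"
    using assms
    by (auto simp: mem_trap closed_segment_same_snd closed_segment_eq_real_ivl)
  finally show "closed_segment (c, 1) (d, 1) face_of trap a c b d" .
qed

text \<open>Each corner is the intersection of two of the four faces, hence a singleton face, that
  is, an extreme point.\<close>

lemma polygon_vertices_trap:
  assumes "a \<le> b" "c \<le> d"
  shows "polygon_vertices (trap a c b d) = {(a, 0), (c, 1), (b, 0), (d, 1)}"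
proof
  show "polygon_vertices (trap a c b d) \<subseteq> {(a, 0), (c, 1), (b, 0), (d, 1)}"
    using assms by (rule polygon_vertices_trap_subset)
  have "closed_segment (a, 0 :: real) (c, 1) \<inter> closed_segment (a, 0) (b, 0) = {(a, 0)}"
    "closed_segment (b, 0 :: real) (d, 1) \<inter> closed_segment (a, 0) (b, 0) = {(b, 0)}"
    "closed_segment (a, 0 :: real) (c, 1) \<inter> closed_segment (c, 1) (d, 1) = {(c, 1)}"
    "closed_segment (b, 0 :: real) (d, 1) \<inter> closed_segment (c, 1) (d, 1) = {(d, 1)}"
    using assms
    by (auto simp: mem_side_segment closed_segment_same_snd closed_segment_eq_real_ivl)
  then show "{(a, 0), (c, 1), (b, 0), (d, 1)} \<subseteq> polygon_vertices (trap a c b d)"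
    using face_of_Int[OF trap_left_face[OF assms] trap_bottom_face[OF assms]]
      face_of_Int[OF trap_right_face[OF assms] trap_bottom_face[OF assms]]
      face_of_Int[OF trap_left_face[OF assms] trap_top_face[OF assms]]
      face_of_Int[OF trap_right_face[OF assms] trap_top_face[OF assms]]
    by (simp add: polygon_vertices_def face_of_singleton)
qed

section \<open>Edges and bimonotonicity\<close>

lemma aff_dim_closed_segment:
  assumes "u \<noteq> v" shows "aff_dim (closed_segment u v) = 1"
  using assms by (simp add: segment_convex_hull aff_dim_convex_hull aff_dim_2)

lemma trap_left_edge:
  assumes "a \<le> b" "c \<le> d"
  shows "closed_segment (a, 0) (c, 1) edge_of trap a c b d"
  using trap_left_face[OF assms] by (simp add: edge_of_def aff_dim_closed_segment)

lemma trap_right_edge: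
  assumes "a \<le> b" "c \<le> d"
  shows "closed_segment (b, 0) (d, 1) edge_of trap a c b d"
  using trap_right_face[OF assms] by (simp add: edge_of_def aff_dim_closed_segment)

text \<open>A segment determines its unordered pair of ends, and swapping them preserves the slope,
  so the existential in \<open>bimonotone_segment\<close> leaves no freedom.\<close>

lemma bimonotone_side_iff:
  "bimonotone_segment (closed_segment (a, 0) (c, 1)) \<longleftrightarrow> a \<le> c"
proof
  assume "bimonotone_segment (closed_segment (a, 0) (c, 1))"
  then obtain u v where "closed_segment (a, 0) (c, 1) = closed_segment u v"
    and uv: "fst u = fst v \<or> (snd v - snd u) / (fst v - fst u) \<ge> 0"
    by (auto simp: bimonotone_segment_def)
  then have "{(a, 0), (c, 1)} = {u, v}" by (simp only: closed_segment_eq)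
  with uv show "a \<le> c"
    by (auto simp: doubleton_eq_iff zero_le_divide_iff)
next
  assume "a \<le> c"
  then show "bimonotone_segment (closed_segment (a, 0) (c, 1))"
    unfolding bimonotone_segment_def
    by (intro exI[of _ "(a, 0)"] exI[of _ "(c, 1)"]) auto
qed

text \<open>A one-dimensional face is compact, convex and collinear, hence a segment; its ends are
  extreme in the face and therefore in \<open>Q\<close>.\<close>

lemma edge_eq_segment:
  assumes "polytope Q" "e edge_of Q"
  obtains u v where "u \<noteq> v" "e = closed_segment u v"
    "u \<in> polygon_vertices Q" "v \<in> polygon_vertices Q"
proof -
  have face: "e face_of Q" and dim: "aff_dim e = 1"
    using assms(2) by (auto simp: edge_of_def)
  have "compact e" "convex e"
    using assms(1) face by (auto intro: face_of_polytope_polytope polytope_imp_compact polytope_imp_convex)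
  moreover have "e \<noteq> {}" "collinear e" using dim by (auto simp: collinear_aff_dim)
  ultimately obtain u v where e: "e = closed_segment u v"
    using compact_convex_collinear_segment by metis
  moreover have "u \<noteq> v" using dim e by auto
  moreover have "u extreme_point_of Q" "v extreme_point_of Q"
    using extreme_point_of_face[OF face, of u] extreme_point_of_face[OF face, of v]
    by (simp_all add: e extreme_point_of_segment)
  ultimately show ?thesis
    using that by (auto simp: polygon_vertices_def)
qed

text \<open>An edge is known only to join two corners, so diagonals must be considered too.
  Horizontal edges are harmless, \<open>a \<le> c \<le> d\<close> settles one diagonal, and only the
  one from \<open>(b, 0)\<close> to \<open>(c, 1)\<close> needs an argument.\<close>

lemma bimonotone_trap_iff:
  assumes "a \<le> b" "c \<le> d"
  shows "bimonotone_polygon (trap a c b d) \<longleftrightarrow> a \<le> c \<and> b \<le> d"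
proof
  assume "bimonotone_polygon (trap a c b d)"
  then show "a \<le> c \<and> b \<le> d"
    using trap_left_edge[OF assms] trap_right_edge[OF assms]
    by (metis bimonotone_polygon_def bimonotone_side_iff)
next
  assume le: "a \<le> c \<and> b \<le> d"
  have *: "b \<le> c" if "closed_segment (b, 0) (c, 1) face_of trap a c b d"
  proof (rule ccontr)
    assume "\<not> b \<le> c"
    with le have lt: "a < b" "c < d" by auto
    \<comment> \<open>If \<open>c < b\<close>, this diagonal crosses the interior. The bound keeps
      the points at distance \<epsilon> to the left and right of its midpoint inside the trapezoid,
      although they are off the diagonal.\<close>
    define \<epsilon> where "\<epsilon> = min (b - a) (d - c) / 2"
    have \<epsilon>: "\<epsilon> > 0" "\<epsilon> \<le> (b - a) / 2" "\<epsilon> \<le> (d - c) / 2" using lt by (auto simp: \<epsilon>_def)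
    let ?u = "((b + c) / 2 - \<epsilon>, 1 / 2 :: real)" and ?v = "((b + c) / 2 + \<epsilon>, 1 / 2 :: real)"
    have "((b + c) / 2, 1 / 2) = midpoint ?u ?v"
      by (simp add: midpoint_def)
    then have "((b + c) / 2, 1 / 2) \<in> open_segment ?u ?v"
      using \<epsilon>(1) by (simp add: midpoint_in_open_segment)
    moreover have "?u \<in> trap a c b d" "?v \<in> trap a c b d"
      using \<epsilon> lt by (auto simp: mem_trap field_simps)
    moreover have "((b + c) / 2, 1 / 2 :: real) \<in> closed_segment (b, 0) (c, 1)"
      by (simp add: mem_side_segment field_simps)
    ultimately have "?u \<in> closed_segment (b, 0) (c, 1)"
      using that by (blast dest: face_ofD)
    then show False using \<epsilon>(1) by (simp add: mem_side_segment field_simps)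
  qed
  show "bimonotone_polygon (trap a c b d)"
    unfolding bimonotone_polygon_def
  proof (intro allI impI)
    fix e assume e: "e edge_of trap a c b d"
    obtain u v where uv: "u \<noteq> v" "e = closed_segment u v"
      "u \<in> {(a, 0), (c, 1), (b, 0), (d, 1)}" "v \<in> {(a, 0), (c, 1), (b, 0), (d, 1)}"
      using edge_eq_segment[OF polytope_trap[OF assms] e] polygon_vertices_trap[OF assms] by metis
    show "bimonotone_segment e"
    proof (cases "snd u = snd v")
      case True
      then show ?thesis
        unfolding bimonotone_segment_def using uv(1,2) by (intro exI[of _ u] exI[of _ v]) simp
    next
      case False
      then obtain s t where st: "e = closed_segment (s, 0) (t, 1)" "s \<in> {a, b}" "t \<in> {c, d}"
        using uv by (auto simp: closed_segment_commute)
      then have "s \<le> t"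
        using * e le assms by (auto simp: edge_of_def)
      then show ?thesis using st bimonotone_side_iff by simp
    qed
  qed
qed

section \<open>Trapezoids side by side\<close>

definition face_to_face :: "(real \<times> real) set \<Rightarrow> (real \<times> real) set \<Rightarrow> bool" where
  "face_to_face Q R \<longleftrightarrow> Q \<inter> R = {} \<or>
    (\<exists>v \<in> polygon_vertices Q \<inter> polygon_vertices R. Q \<inter> R = {v}) \<or>
    (Q \<inter> R) edge_of Q \<and> (Q \<inter> R) edge_of R"

lemma face_to_face_sym: "face_to_face Q R \<Longrightarrow> face_to_face R Q"
  by (simp add: face_to_face_def Int_commute conj_commute)

lemma is_subdivision_iff:
  "is_subdivision A S \<longleftrightarrow>
    (\<forall>Q\<in>S. convex_polygon Q \<and> polygon_vertices Q \<subseteq> A) \<and> \<Union>S = convex hull A \<and>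
    (\<forall>Q\<in>S. \<forall>R\<in>S. Q \<noteq> R \<longrightarrow> face_to_face Q R)"
  by (simp only: is_subdivision_def face_to_face_def)

text \<open>The horizontal gap between the facing sides is affine in the height. If it is positive
  at one end, it is positive at all heights strictly between 0 and 1, so the intersection is a
  common side, a common corner or empty.\<close>

lemma face_to_face_trap:
  fixes a c b d a' c' b' d' :: real
  assumes "a \<le> b" "c \<le> d" "b \<le> a'" "d \<le> c'" "a' \<le> b'" "c' \<le> d'"
  defines "Q \<equiv> trap a c b d" and "R \<equiv> trap a' c' b' d'"
  shows "face_to_face Q R"
proof -
  have Int: "(x, y) \<in> Q \<inter> R \<longleftrightarrow> 0 \<le> y \<and> y \<le> 1 \<and>
      (1 - y) * b + y * d = x \<and> (1 - y) * a' + y * c' = x" for x y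
    using interpolate_mono[of a b c d y] interpolate_mono[of b a' d c' y]
      interpolate_mono[of a' b' c' d' y] assms
    by (auto simp: mem_trap)
  have strict: "(1 - y) * b + y * d < (1 - y) * a' + y * c'" if "b < a' \<or> d < c'" "0 < y" "y < 1" for y
    using assms that by (intro interpolate_strict_mono) auto
  consider "b = a'" "d = c'" | "b = a'" "d < c'" | "b < a'" "d = c'" | "b < a'" "d < c'"
    using assms by linarith
  then show ?thesis
  proof cases
    case 1
    then have "(x, y) \<in> Q \<inter> R \<longleftrightarrow> (x, y) \<in> closed_segment (b, 0) (d, 1)" for x y
      unfolding Int by (auto simp: mem_side_segment)
    then have "Q \<inter> R = closed_segment (b, 0) (d, 1)"
      unfolding set_eq_iff split_paired_All by blast
    then show ?thesis
      using trap_right_edge[of a b c d] trap_left_edge[of a' b' c' d'] 1 assms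
      by (simp add: face_to_face_def)
  next
    case 2
    have "(x, y) \<in> Q \<inter> R \<longleftrightarrow> (x, y) = (b, 0)" for x y
    proof (cases "0 < y \<and> y < 1")
      case True
      with strict[of y] 2 Int[of x y] show ?thesis by auto
    next
      case False
      then show ?thesis using 2 Int[of x y] by (cases "y = 1") auto
    qed
    then have "Q \<inter> R = {(b, 0)}" by auto
    then show ?thesis using 2 assms by (simp add: face_to_face_def polygon_vertices_trap)
  next
    case 3
    have "(x, y) \<in> Q \<inter> R \<longleftrightarrow> (x, y) = (d, 1)" for x y
    proof (cases "0 < y \<and> y < 1")
      case True
      with strict[of y] 3 Int[of x y] show ?thesis by auto
    next
      case False
      then show ?thesis using 3 Int[of x y] by (cases "y = 0") auto
    qed
    then have "Q \<inter> R = {(d, 1)}" by auto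
    then show ?thesis using 3 assms by (simp add: face_to_face_def polygon_vertices_trap)
  next
    case 4
    have "(x, y) \<notin> Q \<inter> R" for x y
    proof (cases "0 < y \<and> y < 1")
      case True
      with strict[of y] 4 Int[of x y] show ?thesis by auto
    next
      case False
      then show ?thesis using 4 Int[of x y] by (cases "y = 0"; cases "y = 1") auto
    qed
    then show ?thesis by (auto simp: face_to_face_def)
  qed
qed

lemma trap_Un_trap:
  assumes "a \<le> b" "c \<le> d" "b \<le> b'" "d \<le> d'"
  shows "trap a c b d \<union> trap b d b' d' = trap a c b' d'"
proof -
  have "(x, y) \<in> trap a c b d \<union> trap b d b' d' \<longleftrightarrow> (x, y) \<in> trap a c b' d'" for x y
    using interpolate_mono[of a b c d y] interpolate_mono[of b b' d d' y] assms
    by (auto simp: mem_trap)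
  then show ?thesis by auto
qed

section \<open>Polygons with vertices in the grid\<close>

lemma corners_in_trap:
  assumes "a \<le> b" "c \<le> d"
  shows "(a, 0) \<in> trap a c b d" "(c, 1) \<in> trap a c b d"
    "(b, 0) \<in> trap a c b d" "(d, 1) \<in> trap a c b d"
  using assms by (auto simp: mem_trap)

lemma trap_subset_imp_le:
  assumes "trap a c b d \<subseteq> trap a' c' b' d'" "a \<le> b" "c \<le> d"
  shows "a' \<le> a" "c' \<le> c" "b \<le> b'" "d \<le> d'"
  using corners_in_trap[OF assms(2,3), THEN subsetD[OF assms(1)]] by (simp_all add: mem_trap)

text \<open>With \<open>Suc\<close>, \<open>b\<close> and \<open>d\<close> are the coordinates of
  the rightmost points. The grid takes the size of its top row first, whereas \<open>trap\<close>
  lists bottom ends first.\<close>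

lemma convex_hull_two_row_grid:
  "convex hull (two_row_grid (Suc d) (Suc b)) = trap 0 0 (real b) (real d)"
proof
  show "convex hull (two_row_grid (Suc d) (Suc b)) \<subseteq> trap 0 0 (real b) (real d)"
    by (intro hull_minimal convex_trap) (auto simp: two_row_grid_def mem_trap)
  have "{(0, 0), (0, 1), (real b, 0), (real d, 1)} \<subseteq> two_row_grid (Suc d) (Suc b)"
    by (auto simp: two_row_grid_def)
  then have "convex hull {(0, 0), (0, 1), (real b, 0), (real d, 1)}
      \<subseteq> convex hull (two_row_grid (Suc d) (Suc b))"
    by (rule hull_mono)
  then show "trap 0 0 (real b) (real d) \<subseteq> convex hull (two_row_grid (Suc d) (Suc b))"
    by (simp add: trap_eq_hull)
qed

text \<open>A polygon is the hull of its vertices, and nonempty interior forces vertices on both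
  rows. The extreme columns on each row are the corners.\<close>

lemma polygon_in_grid_eq_trap:
  assumes "convex_polygon Q" "polygon_vertices Q \<subseteq> two_row_grid m n"
  obtains a c b d :: nat where "a \<le> b" "c \<le> d" "a < b \<or> c < d" "b < n" "d < m"
    "Q = trap a c b d"
proof -
  define V where "V = polygon_vertices Q"
  have Q: "Q = convex hull V"
    unfolding V_def polygon_vertices_def using assms(1)
    by (intro Krein_Milman_Minkowski polytope_imp_compact polytope_imp_convex)
      (auto simp: convex_polygon_def)
  define I J where "I = {i. (real i, 0) \<in> V}" and "J = {j. (real j, 1) \<in> V}"
  have V: "V \<subseteq> two_row_grid m n" using assms(2) by (simp add: V_def)
  have IJ: "I \<subseteq> {..<n}" "J \<subseteq> {..<m}"
    using V by (auto simp: I_def J_def two_row_grid_def)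
  then have fin: "finite I" "finite J" by (auto intro: finite_subset)
  have V_cases: "(\<exists>i\<in>I. v = (real i, 0)) \<or> (\<exists>j\<in>J. v = (real j, 1))" if "v \<in> V" for v
    using that V by (auto simp: I_def J_def two_row_grid_def)
  have int: "interior Q \<noteq> {}" using assms(1) by (simp add: convex_polygon_def)
  \<comment> \<open>Applied at heights 1 and 0 to show that \<open>I\<close> and \<open>J\<close>
    are nonempty.\<close>
  have not_flat: "\<not> V \<subseteq> {z. (0, 1) \<bullet> z = t}" for t :: real
  proof
    assume "V \<subseteq> {z. (0, 1) \<bullet> z = t}"
    then have "Q \<subseteq> {z. (0, 1) \<bullet> z = t}"
      unfolding Q by (rule hull_minimal) (rule convex_hyperplane)
    then have "interior Q \<subseteq> interior {z. (0 :: real, 1) \<bullet> z = t}"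
      by (rule interior_mono)
    moreover have "interior {z. (0 :: real, 1 :: real) \<bullet> z = t} = {}"
      by (rule interior_hyperplane) (simp add: zero_prod_def)
    ultimately show False using int by simp
  qed
  have "I \<noteq> {}"
  proof
    assume "I = {}"
    with V_cases have "V \<subseteq> {z. (0, 1) \<bullet> z = (1 :: real)}" by auto
    with not_flat show False by blast
  qed
  have "J \<noteq> {}"
  proof
    assume "J = {}"
    with V_cases have "V \<subseteq> {z. (0, 1) \<bullet> z = (0 :: real)}" by auto
    with not_flat show False by blast
  qed
  let ?a = "Min I" and ?b = "Max I" and ?c = "Min J" and ?d = "Max J"
  have mem: "?a \<in> I" "?b \<in> I" "?c \<in> J" "?d \<in> J"
    using fin \<open>I \<noteq> {}\<close> \<open>J \<noteq> {}\<close> by auto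
  have le: "?a \<le> ?b" "?c \<le> ?d" using mem fin by auto
  have "V \<subseteq> trap ?a ?c ?b ?d"
  proof
    fix v assume "v \<in> V"
    with V_cases consider i where "i \<in> I" "v = (real i, 0)" | j where "j \<in> J" "v = (real j, 1)"
      by blast
    then show "v \<in> trap ?a ?c ?b ?d"
      using fin by cases (simp_all add: mem_trap)
  qed
  then have "Q \<subseteq> trap ?a ?c ?b ?d"
    unfolding Q by (intro hull_minimal convex_trap)
  moreover have "{(real ?a, 0), (real ?c, 1), (real ?b, 0), (real ?d, 1)} \<subseteq> V"
    using mem by (auto simp: I_def J_def)
  then have "convex hull {(real ?a, 0), (real ?c, 1), (real ?b, 0), (real ?d, 1)} \<subseteq> convex hull V"
    by (rule hull_mono)
  then have "trap ?a ?c ?b ?d \<subseteq> Q"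
    using le trap_eq_hull[of ?a ?b ?c ?d] by (simp only: Q[symmetric] of_nat_le_iff)
  ultimately have Q_eq: "Q = trap ?a ?c ?b ?d" by blast
  then have "?a < ?b \<or> ?c < ?d"
    using int interior_trap_nonempty_iff[of ?a ?b ?c ?d] le by simp
  with le mem IJ Q_eq show ?thesis by (intro that[of ?a ?b ?c ?d]) auto
qed

section \<open>Separation of polygons with disjoint interiors\<close>

lemma subdivision_interiors_disjoint:
  assumes "is_subdivision A S" "Q \<in> S" "R \<in> S" "Q \<noteq> R"
  shows "interior Q \<inter> interior R = {}"
proof (rule ccontr)
  assume "interior Q \<inter> interior R \<noteq> {}"
  then have "interior (Q \<inter> R) \<noteq> {}" by simp
  \<comment> \<open>Face-to-face polygons share a set of dimension at most 1.\<close>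
  then have "aff_dim (Q \<inter> R) = 2"
    using aff_dim_nonempty_interior[of "Q \<inter> R"] by simp
  moreover have "face_to_face Q R"
    using assms by (simp add: is_subdivision_iff)
  ultimately show False
    by (auto simp: face_to_face_def edge_of_def)
qed

text \<open>Let \<open>y\<close> tend to 0 and to 1; interiors give information only at heights
  strictly in between.\<close>

lemma interpolate_le_imp_le:
  assumes "\<And>y. 0 < y \<Longrightarrow> y < 1 \<Longrightarrow> (1 - y) * b + y * d \<le> (1 - y) * a + y * (c :: real)"
  shows "b \<le> a" "d \<le> c"
proof -
  have "((\<lambda>y. (1 - y) * b + y * d) \<longlongrightarrow> (1 - 0) * b + 0 * d) (at_right 0)"
    "((\<lambda>y. (1 - y) * a + y * c) \<longlongrightarrow> (1 - 0) * a + 0 * c) (at_right 0)"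
    by (intro tendsto_intros)+
  moreover have "\<forall>\<^sub>F y in at_right 0. (1 - y) * b + y * d \<le> (1 - y) * a + y * c"
    using eventually_at_right_less[of 0] eventually_at_right_real[of 0 1]
    by (auto elim!: eventually_mono intro: assms)
  ultimately show "b \<le> a" using tendsto_le[OF trivial_limit_at_right_real] by fastforce
  have "((\<lambda>y. (1 - y) * b + y * d) \<longlongrightarrow> (1 - 1) * b + 1 * d) (at_left 1)"
    "((\<lambda>y. (1 - y) * a + y * c) \<longlongrightarrow> (1 - 1) * a + 1 * c) (at_left 1)"
    by (intro tendsto_intros)+
  moreover have "\<forall>\<^sub>F y in at_left 1. (1 - y) * b + y * d \<le> (1 - y) * a + y * c"
    using eventually_at_left_real[of 0 1]
    by (auto elim!: eventually_mono intro: assms)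
  ultimately show "d \<le> c" using tendsto_le[OF trivial_limit_at_left_real] by fastforce
qed

text \<open>The second trapezoid ends no further right than the first. If at some height it passed
  the left side of the first, any \<open>x\<close> between \<open>?l\<close> and \<open>?r\<close>
  would give a common interior point.\<close>

lemma disjoint_from_last_trap:
  assumes "a \<le> b" "c \<le> d" "a < b \<or> c < d"
    and "a' \<le> b'" "c' \<le> d'" "a' < b' \<or> c' < d'" "b' \<le> b" "d' \<le> d"
    and disj: "interior (trap a c b d) \<inter> interior (trap a' c' b' d') = {}"
  shows "b' \<le> a" "d' \<le> c"
proof -
  have "(1 - y) * b' + y * d' \<le> (1 - y) * a + y * c" if y: "0 < y" "y < 1" for y
  proof (rule ccontr)
    let ?l = "max ((1 - y) * a + y * c) ((1 - y) * a' + y * c')" and ?r = "(1 - y) * b' + y * d'"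
    assume "\<not> ?thesis"
    then have "?l < ?r"
      using interpolate_strict_mono[of a' b' c' d' y] assms y by auto
    then obtain x where "?l < x" "x < ?r" using dense by blast
    moreover have "?r \<le> (1 - y) * b + y * d"
      using assms y by (intro interpolate_mono) auto
    ultimately have "(x, y) \<in> interior (trap a c b d) \<inter> interior (trap a' c' b' d')"
      using y by (auto simp: interior_trap)
    with disj show False by blast
  qed
  note le = this
  show "b' \<le> a" by (rule interpolate_le_imp_le(1)[OF le])
  show "d' \<le> c" by (rule interpolate_le_imp_le(2)[OF le])
qed

section \<open>Inserting and removing the last trapezoid\<close>

text \<open>The empty subdivision of the segment from \<open>(0, 0)\<close> to \<open>(0, 1)\<close> starts the recursion.\<close>

definition left_subdivisions :: "nat \<Rightarrow> nat \<Rightarrow> (real \<times> real) set set set" where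
  "left_subdivisions a c =
    (if a = 0 \<and> c = 0 then {{}} else bimonotone_subdivisions (two_row_grid (Suc c) (Suc a)))"

lemma finite_left_subdivisions: "finite (left_subdivisions a c)"
proof -
  have "finite (two_row_grid (Suc c) (Suc a))"
    by (auto simp: two_row_grid_def)
  then show ?thesis by (simp add: left_subdivisions_def finite_bimonotone_subdivisions)
qed

lemma bimonotone_subdivision_elem:
  assumes "S \<in> bimonotone_subdivisions (two_row_grid (Suc d) (Suc b))" "R \<in> S"
  obtains a' c' b' d' :: nat where "a' \<le> b'" "c' \<le> d'" "a' < b' \<or> c' < d'" "b' \<le> b" "d' \<le> d"
    "a' \<le> c'" "b' \<le> d'" "R = trap a' c' b' d'"
proof -
  have "convex_polygon R" "polygon_vertices R \<subseteq> two_row_grid (Suc d) (Suc b)" "bimonotone_polygon R"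
    using assms by (auto simp: bimonotone_subdivisions_def is_subdivision_def)
  then obtain a' c' b' d' :: nat where *: "a' \<le> b'" "c' \<le> d'" "a' < b' \<or> c' < d'"
      "b' < Suc b" "d' < Suc d" "R = trap a' c' b' d'"
    using polygon_in_grid_eq_trap by metis
  with \<open>bimonotone_polygon R\<close> have "a' \<le> c'" "b' \<le> d'"
    using bimonotone_trap_iff[of a' b' c' d'] by simp_all
  with * show ?thesis by (intro that) auto
qed

lemma left_subdivision_elem:
  assumes "S \<in> left_subdivisions b d" "R \<in> S"
  obtains a' c' b' d' :: nat where "a' \<le> b'" "c' \<le> d'" "a' < b' \<or> c' < d'" "b' \<le> b" "d' \<le> d"
    "a' \<le> c'" "b' \<le> d'" "R = trap a' c' b' d'"
proof -
  \<comment> \<open>The base case is excluded, since there \<open>S\<close> is empty and cannot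
    contain \<open>R\<close>.\<close>
  have "S \<in> bimonotone_subdivisions (two_row_grid (Suc d) (Suc b))"
    using assms by (auto simp: left_subdivisions_def split: if_splits)
  then show ?thesis
    using assms(2) that by (rule bimonotone_subdivision_elem)
qed

lemma polygon_vertices_trap_in_grid:
  fixes a c b d :: nat
  assumes "a \<le> b" "c \<le> d" "b \<le> b'" "d \<le> d'"
  shows "polygon_vertices (trap a c b d) \<subseteq> two_row_grid (Suc d') (Suc b')"
  using assms by (auto simp: polygon_vertices_trap two_row_grid_def)

text \<open>All members of \<open>S\<close> lie to the left of the new trapezoid, so
  \<open>face_to_face_trap\<close> applies, and the two regions are glued along their common
  side.\<close>

lemma insert_last_trap:
  fixes a c b d :: nat
  assumes le: "a \<le> b" "c \<le> d" "a < b \<or> c < d" "a \<le> c" "b \<le> d" and S: "S \<in> left_subdivisions a c"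
  shows "insert (trap a c b d) S \<in> bimonotone_subdivisions (two_row_grid (Suc d) (Suc b))"
proof -
  let ?Q = "trap a c b d" and ?A = "two_row_grid (Suc d) (Suc b)"
  have elem: "convex_polygon R \<and> polygon_vertices R \<subseteq> ?A \<and> bimonotone_polygon R \<and> face_to_face R ?Q"
    if "R \<in> S" for R
  proof -
    from S that obtain a' c' b' d' :: nat where *: "a' \<le> b'" "c' \<le> d'" "a' < b' \<or> c' < d'"
        "b' \<le> a" "d' \<le> c" "a' \<le> c'" "b' \<le> d'" and R: "R = trap a' c' b' d'"
      by (rule left_subdivision_elem)
    have "convex_polygon R" "bimonotone_polygon R"
      using * R by (simp_all add: convex_polygon_trap bimonotone_trap_iff)
    moreover have "polygon_vertices R \<subseteq> ?A"
      unfolding R using * le by (intro polygon_vertices_trap_in_grid) auto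
    moreover have "face_to_face R ?Q"
      unfolding R using * le by (intro face_to_face_trap) auto
    ultimately show ?thesis by blast
  qed
  have meet: "face_to_face R R'" if "R \<in> S" "R' \<in> S" "R \<noteq> R'" for R R'
    using that S by (auto simp: left_subdivisions_def bimonotone_subdivisions_def is_subdivision_iff
        split: if_splits)
  have Q: "convex_polygon ?Q" "bimonotone_polygon ?Q" "polygon_vertices ?Q \<subseteq> ?A"
    using le by (simp_all add: convex_polygon_trap bimonotone_trap_iff polygon_vertices_trap_in_grid)
  have "\<Union>(insert ?Q S) = convex hull ?A"
  proof (cases "a = 0 \<and> c = 0")
    case True
    with S show ?thesis by (simp add: left_subdivisions_def convex_hull_two_row_grid)
  next
    case False
    with S have "\<Union>S = trap 0 0 a c"
      by (auto simp: left_subdivisions_def bimonotone_subdivisions_def is_subdivision_iff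
          convex_hull_two_row_grid)
    then show ?thesis
      using trap_Un_trap[of 0 a 0 c b d] le by (simp add: convex_hull_two_row_grid Un_commute)
  qed
  moreover have "\<forall>R\<in>insert ?Q S. \<forall>R'\<in>insert ?Q S. R \<noteq> R' \<longrightarrow> face_to_face R R'"
  proof (intro ballI impI)
    fix R R' assume "R \<in> insert ?Q S" "R' \<in> insert ?Q S" "R \<noteq> R'"
    then consider "R \<in> S" "R' \<in> S" | "R = ?Q" "R' \<in> S" | "R \<in> S" "R' = ?Q" by blast
    then show "face_to_face R R'"
    proof cases
      case 1
      with \<open>R \<noteq> R'\<close> show ?thesis by (simp add: meet)
    next
      case 2
      with elem[of R'] show ?thesis by (blast intro: face_to_face_sym)
    next
      case 3
      with elem[of R] show ?thesis by simp
    qed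
  qed
  moreover have "\<forall>R\<in>insert ?Q S. convex_polygon R \<and> polygon_vertices R \<subseteq> ?A"
    using elem Q by auto
  moreover have "\<forall>R\<in>insert ?Q S. bimonotone_polygon R"
    using elem Q by auto
  ultimately show ?thesis
    unfolding bimonotone_subdivisions_def is_subdivision_iff mem_Collect_eq by (intro conjI)
qed

text \<open>Some member contains the midpoint of the right side of the strip. Its right ends satisfy
  \<open>b' \<le> b\<close> and \<open>d' \<le> d\<close> but have sum at least
  \<open>b + d\<close>, so they coincide with the corners; bimonotonicity then yields
  \<open>b \<le> d\<close>.\<close>

lemma obtain_last_trap:
  fixes b d :: nat
  assumes S: "S \<in> bimonotone_subdivisions (two_row_grid (Suc d) (Suc b))"
  obtains a c :: nat where "a \<le> b" "c \<le> d" "a < b \<or> c < d" "a \<le> c" "b \<le> d" "trap a c b d \<in> S"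
proof -
  have "\<Union>S = trap 0 0 b d"
    using S by (simp add: bimonotone_subdivisions_def is_subdivision_def convex_hull_two_row_grid)
  moreover have "((real b + real d) / 2, 1 / 2) \<in> trap 0 0 b d"
    by (simp add: mem_trap field_simps)
  ultimately obtain R where R: "R \<in> S" "((real b + real d) / 2, 1 / 2) \<in> R" by blast
  from S R(1) obtain a c b' d' :: nat where *: "a \<le> b'" "c \<le> d'" "a < b' \<or> c < d'"
      "b' \<le> b" "d' \<le> d" "a \<le> c" "b' \<le> d'" "R = trap a c b' d'"
    by (rule bimonotone_subdivision_elem)
  with R(2) have "real b + real d \<le> real b' + real d'"
    by (simp add: mem_trap field_simps)
  with * have "b' = b" "d' = d" by linarith+
  with * R(1) show ?thesis by (intro that) auto
qed

text \<open>Disjoint interiors push the other members to the left of \<open>trap a c b d\<close>.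
  What needs proof is that they still cover the whole left part.\<close>

lemma remove_last_trap:
  fixes a c b d :: nat
  assumes S: "S \<in> bimonotone_subdivisions (two_row_grid (Suc d) (Suc b))"
    and le: "a \<le> b" "c \<le> d" "a < b \<or> c < d" and Q: "trap a c b d \<in> S"
  shows "S - {trap a c b d} \<in> left_subdivisions a c"
proof -
  let ?Q = "trap a c b d"
  have sub: "is_subdivision (two_row_grid (Suc d) (Suc b)) S"
    using S by (simp add: bimonotone_subdivisions_def)
  have elem: "\<exists>a' c' b' d' :: nat. a' \<le> b' \<and> c' \<le> d' \<and> (a' < b' \<or> c' < d') \<and> b' \<le> a \<and> d' \<le> c \<and>
      a' \<le> c' \<and> b' \<le> d' \<and> R = trap a' c' b' d'" if R: "R \<in> S - {?Q}" for R
  proof -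
    from S R obtain a' c' b' d' :: nat where *: "a' \<le> b'" "c' \<le> d'" "a' < b' \<or> c' < d'"
        "b' \<le> b" "d' \<le> d" "a' \<le> c'" "b' \<le> d'" "R = trap a' c' b' d'"
      using bimonotone_subdivision_elem by (metis Diff_iff)
    have "interior ?Q \<inter> interior R = {}"
      using subdivision_interiors_disjoint[OF sub Q] R by blast
    then have "real b' \<le> real a" "real d' \<le> real c"
      using disjoint_from_last_trap[of a b c d a' b' c' d'] * le by simp_all
    with * show ?thesis by auto
  qed
  show ?thesis
  proof (cases "a = 0 \<and> c = 0")
    case True
    \<comment> \<open>A remaining member would have both right ends at 0 and thus be
      degenerate.\<close>
    have "S - {?Q} = {}"
    proof (rule ccontr)
      assume "S - {?Q} \<noteq> {}"
      then obtain R where "R \<in> S - {?Q}" by blast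
      with elem[OF this] True show False by auto
    qed
    with True show ?thesis by (simp add: left_subdivisions_def)
  next
    case False
    let ?A = "two_row_grid (Suc c) (Suc a)" and ?T = "trap 0 0 a c"
    have elem': "polygon_vertices R \<subseteq> ?A \<and> R \<subseteq> ?T" if "R \<in> S - {?Q}" for R
    proof -
      from elem[OF that] obtain a' c' b' d' :: nat where *: "a' \<le> b'" "c' \<le> d'"
          "b' \<le> a" "d' \<le> c" "R = trap a' c' b' d'" by blast
      then have "polygon_vertices R \<subseteq> ?A" by (simp add: polygon_vertices_trap_in_grid)
      moreover have "{(real a', 0), (real c', 1), (real b', 0), (real d', 1)} \<subseteq> ?T"
        using * by (auto simp: mem_trap)
      then have "R \<subseteq> ?T"
        using * by (simp add: trap_eq_hull[of a' b' c' d'] hull_minimal convex_trap)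
      ultimately show ?thesis ..
    qed
    have finS: "finite S"
    proof -
      have "S \<subseteq> (\<lambda>(a, c, b, d). trap (real a) (real c) (real b) (real d)) ` ({..b} \<times> {..d} \<times> {..b} \<times> {..d})"
      proof
        fix R assume "R \<in> S"
        with S obtain a' c' b' d' :: nat where "a' \<le> b'" "c' \<le> d'"
            "b' \<le> b" "d' \<le> d" "R = trap a' c' b' d'"
          using bimonotone_subdivision_elem by metis
        then show "R \<in> (\<lambda>(a, c, b, d). trap (real a) (real c) (real b) (real d)) ` ({..b} \<times> {..d} \<times> {..b} \<times> {..d})"
          by (intro image_eqI[of _ _ "(a', c', b', d')"]) auto
      qed
      then show ?thesis by (rule finite_subset) auto
    qed
    have "\<Union>(S - {?Q}) = ?T"
    proof
      show "\<Union>(S - {?Q}) \<subseteq> ?T" using elem' by blast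
      \<comment> \<open>Interior points of \<open>?T\<close> miss \<open>?Q\<close>, so the
        remaining members cover them. A finite union of closed sets is closed and hence also
        contains the boundary of \<open>?T\<close>.\<close>
      have "closed (\<Union>(S - {?Q}))"
      proof (rule closed_Union)
        show "\<forall>R\<in>S - {?Q}. closed R" using elem closed_trap by blast
      qed (use finS in auto)
      moreover have "interior ?T \<subseteq> \<Union>(S - {?Q})"
      proof clarify
        fix x y assume xy: "(x, y) \<in> interior ?T"
        then have "(x, y) \<in> trap 0 0 b d" using interior_subset[of ?T] trap_Un_trap[of 0 a 0 c b d] le by auto
        then have "(x, y) \<in> \<Union>S"
          using sub by (simp add: is_subdivision_iff convex_hull_two_row_grid)
        moreover have "(x, y) \<notin> ?Q" using xy by (auto simp: interior_trap mem_trap)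
        ultimately show "(x, y) \<in> \<Union>(S - {?Q})" by blast
      qed
      ultimately have "closure (interior ?T) \<subseteq> \<Union>(S - {?Q})" by (rule closure_minimal[rotated])
      moreover have "interior ?T \<noteq> {}" using interior_trap_nonempty_iff[of 0 a 0 c] False by auto
      then have "closure (interior ?T) = ?T"
        using convex_closure_interior[OF convex_trap] closed_trap by simp
      ultimately show "?T \<subseteq> \<Union>(S - {?Q})" by simp
    qed
    then have "S - {?Q} \<in> bimonotone_subdivisions ?A"
      using S elem' unfolding bimonotone_subdivisions_def is_subdivision_iff convex_hull_two_row_grid
      by simp
    then show ?thesis using False by (auto simp: left_subdivisions_def)
  qed
qed

section \<open>Counting by the left side of the last trapezoid\<close>

definition left_ends :: "nat \<Rightarrow> nat \<Rightarrow> (nat \<times> nat) set" where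
  "left_ends b d = {(a, c). a \<le> b \<and> c \<le> d \<and> (a < b \<or> c < d) \<and> a \<le> c}"

lemma finite_left_ends: "finite (left_ends b d)"
  by (rule finite_subset[of _ "{..b} \<times> {..d}"]) (auto simp: left_ends_def)

lemma bimonotone_subdivisions_decomp:
  assumes "b \<le> d"
  shows "bimonotone_subdivisions (two_row_grid (Suc d) (Suc b)) =
    (\<lambda>((a, c), S). insert (trap (real a) (real c) (real b) (real d)) S) `
      (SIGMA (a, c):left_ends b d. left_subdivisions a c)" (is "?L = ?f ` ?R")
proof
  show "?f ` ?R \<subseteq> ?L"
    using assms by (auto simp: left_ends_def intro!: insert_last_trap)
  show "?L \<subseteq> ?f ` ?R"
  proof
    fix S assume S: "S \<in> ?L"
    then obtain a c :: nat where *: "a \<le> b" "c \<le> d" "a < b \<or> c < d" "a \<le> c" "trap a c b d \<in> S"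
      by (rule obtain_last_trap)
    with S have "S - {trap a c b d} \<in> left_subdivisions a c"
      by (intro remove_last_trap)
    with * show "S \<in> ?f ` ?R"
      by (intro image_eqI[of _ _ "((a, c), S - {trap a c b d})"]) (auto simp: left_ends_def)
  qed
qed

text \<open>Members of \<open>S\<close> end at or before \<open>(a', c')\<close>, which is strictly
  smaller than \<open>(b, d)\<close> in some coordinate. The left side \<open>(a, c)\<close> is
  independent of \<open>S\<close>, as injectivity requires.\<close>

lemma trap_notin_left_subdivision:
  assumes "S \<in> left_subdivisions a' c'" "(a', c') \<in> left_ends b d" "(a, c) \<in> left_ends b d"
  shows "trap (real a) (real c) (real b) (real d) \<notin> S"
proof
  assume "trap (real a) (real c) (real b) (real d) \<in> S"
  with assms(1) obtain a1 c1 b1 d1 :: nat where *: "b1 \<le> a'" "d1 \<le> c'"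
      "trap (real a) (real c) (real b) (real d) = trap a1 c1 b1 d1"
    by (rule left_subdivision_elem)
  then have "real b \<le> real b1" "real d \<le> real d1"
    using trap_subset_imp_le[of a c b d a1 c1 b1 d1] assms(3) by (auto simp: left_ends_def)
  with * assms(2) show False by (auto simp: left_ends_def)
qed

lemma inj_on_insert_last_trap:
  "inj_on (\<lambda>((a, c), S). insert (trap (real a) (real c) (real b) (real d)) S)
      (SIGMA (a, c):left_ends b d. left_subdivisions a c)"
proof (rule inj_onI, clarsimp)
  fix a c S a' c' S'
  assume p: "(a, c) \<in> left_ends b d" "(a', c') \<in> left_ends b d"
    and S: "S \<in> left_subdivisions a c" "S' \<in> left_subdivisions a' c'"
    and eq: "insert (trap (real a) (real c) (real b) (real d)) S =
      insert (trap (real a') (real c') (real b) (real d)) S'"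
  \<comment> \<open>The last trapezoid of one side is not in the remainder of the other, so the two
    last trapezoids agree, and mutual inclusion recovers their left ends.\<close>
  have notin: "trap (real a) (real c) (real b) (real d) \<notin> S'"
    using trap_notin_left_subdivision[OF S(2) p(2) p(1)] .
  with eq have eq': "trap (real a) (real c) (real b) (real d) = trap (real a') (real c') (real b) (real d)"
    by blast
  then have "a = a'" "c = c'"
    using trap_subset_imp_le[of a c b d a' c' b d] trap_subset_imp_le[of a' c' b d a c b d] p
    by (auto simp: left_ends_def intro!: antisym)
  moreover have "S = S'"
    using eq eq' notin trap_notin_left_subdivision[OF S(1) p(1) p(1)] by (metis insert_ident)
  ultimately show "a = a' \<and> c = c' \<and> S = S'" by simp
qed

lemma card_bimonotone_subdivisions_recursion:
  assumes "b \<le> d"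
  shows "card (bimonotone_subdivisions (two_row_grid (Suc d) (Suc b))) =
    (\<Sum>(a, c)\<in>left_ends b d. card (left_subdivisions a c))"
proof -
  have "card (bimonotone_subdivisions (two_row_grid (Suc d) (Suc b))) =
      card (SIGMA p:left_ends b d. left_subdivisions (fst p) (snd p))"
    using card_image[OF inj_on_insert_last_trap[of b d]] bimonotone_subdivisions_decomp[OF assms]
    by (simp add: case_prod_unfold)
  also have "\<dots> = (\<Sum>p\<in>left_ends b d. card (left_subdivisions (fst p) (snd p)))"
    by (intro card_SigmaI finite_left_ends ballI finite_left_subdivisions)
  finally show ?thesis by (simp add: case_prod_unfold)
qed

section \<open>The recurrence\<close>

lemma bimonotone_subdivisions_empty:
  assumes "d < b"
  shows "bimonotone_subdivisions (two_row_grid (Suc d) (Suc b)) = {}"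
proof (rule ccontr)
  assume "bimonotone_subdivisions (two_row_grid (Suc d) (Suc b)) \<noteq> {}"
  then obtain S where "S \<in> bimonotone_subdivisions (two_row_grid (Suc d) (Suc b))" by blast
  then show False by (rule obtain_last_trap) (use assms in auto)
qed

text \<open>Integer-valued so that the subtraction in the recurrence is not truncated. The value 1
  at \<open>(0, 0)\<close> is the convention for the empty strip.\<close>

definition left_count :: "nat \<Rightarrow> nat \<Rightarrow> int" where
  "left_count a c = int (card (left_subdivisions a c))"

lemma left_count_eq_B: "a \<noteq> 0 \<or> c \<noteq> 0 \<Longrightarrow> left_count a c = int (B (Suc c) (Suc a))"
  by (auto simp: left_count_def left_subdivisions_def B_def)

lemma left_count_eq_0: "c < a \<Longrightarrow> left_count a c = 0"
  by (simp add: left_count_def left_subdivisions_def bimonotone_subdivisions_empty)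

text \<open>Pairs with \<open>c < a\<close> contribute 0. The corner \<open>(b, d)\<close> gives one
  copy of \<open>left_count b d\<close>, the remaining pairs in \<open>left_ends b d\<close>
  another; \<open>d \<noteq> 0\<close> keeps the corner away from the base case.\<close>

lemma sum_left_count:
  assumes "b \<le> d" "d \<noteq> 0"
  shows "(\<Sum>a\<le>b. \<Sum>c\<le>d. left_count a c) = 2 * left_count b d"
proof -
  have "(\<Sum>a\<le>b. \<Sum>c\<le>d. left_count a c) = (\<Sum>(a, c)\<in>{..b} \<times> {..d}. left_count a c)"
    by (simp add: sum.cartesian_product)
  also have "\<dots> = (\<Sum>(a, c)\<in>insert (b, d) (left_ends b d). left_count a c)"
    by (rule sum.mono_neutral_right) (use assms in \<open>auto simp: left_ends_def intro: left_count_eq_0\<close>)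
  also have "\<dots> = left_count b d + (\<Sum>(a, c)\<in>left_ends b d. left_count a c)"
    by (subst sum.insert) (auto simp: finite_left_ends, auto simp: left_ends_def)
  also have "(\<Sum>(a, c)\<in>left_ends b d. left_count a c) = left_count b d"
    using card_bimonotone_subdivisions_recursion[OF assms(1)] assms(2)
    by (simp add: left_count_def left_subdivisions_def[of b d] case_prod_unfold)
  finally show ?thesis by simp
qed

text \<open>Enlarging the rectangle from \<open>k\<close> to \<open>Suc k\<close> adds a single
  nonzero term, \<open>left_count (Suc k) (Suc k)\<close>; compare the two doubled corner
  values.\<close>

lemma left_count_diagonal: "left_count (Suc k) (Suc k) = 2 * left_count k (Suc k)"
proof -
  have "(\<Sum>c\<le>k. left_count (Suc k) c) = 0"
    by (intro sum.neutral) (auto intro: left_count_eq_0)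
  then show ?thesis using sum_left_count[of k "Suc k"] sum_left_count[of "Suc k" "Suc k"] by simp
qed

text \<open>Inclusion-exclusion for four rectangles; \<open>b < d\<close> makes
  \<open>sum_left_count\<close> applicable to each of them.\<close>

lemma left_count_above_diagonal:
  assumes "b < d"
  shows "left_count (Suc b) (Suc d) = 2 * left_count b (Suc d) + 2 * left_count (Suc b) d - 2 * left_count b d"
  using sum_left_count[of "Suc b" "Suc d"] sum_left_count[of b "Suc d"] sum_left_count[of "Suc b" d] sum_left_count[of b d] assms
  by (simp add: sum.distrib)

theorem lemma1:
  fixes m n :: nat
  assumes "m \<ge> 1" and "n \<ge> 2"
  shows "int (B m n) =
    (if m > n then 2 * int (B m (n - 1)) + 2 * int (B (m - 1) n) - 2 * int (B (m - 1) (n - 1))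
     else if m = n then 2 * int (B m (n - 1))
     else 0)"
proof -
  obtain d where m: "m = Suc d" using assms(1) by (cases m) auto
  obtain b where n: "n = Suc (Suc b)" using assms(2) by (metis add_2_eq_Suc le_Suc_ex)
  consider "m > n" | "m = n" | "m < n" by linarith
  then show ?thesis
  proof cases
    case 1
    \<comment> \<open>As \<open>b < e\<close>, none of the four index pairs is
      \<open>(0, 0)\<close>, so \<open>left_count\<close> agrees with \<open>B\<close> at all of
      them.\<close>
    then obtain e where "d = Suc e" "b < e" using m n by (cases d) auto
    then show ?thesis using m n 1 left_count_above_diagonal[of b e] by (simp add: left_count_eq_B)
  next
    case 2
    then show ?thesis using m n left_count_diagonal[of b] by (simp add: left_count_eq_B)
  next
    case 3
    then show ?thesis using m n left_count_eq_0[of d "Suc b"] by (simp add: left_count_eq_B)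
  qed
qed

end
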